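(* Let $(G,A,\sigma,\delta)$ be a matched pair of groups and let $S=A\times G$ be the Cartesian product of $A$ and $G$. Then the map $s:S\times S\to S\times S$ defined by $$s((a,x),(b,y))=\big((a,xy),\ (b(\delta_x(a))^{-1},\ \sigma_{\delta_x(a)}(y))\big)$$ is an irretractable bijective set-theoretic solution to the Pentagon Equation.
   Context: A set-theoretic solution to the Pentagon Equation is a pair $(S,s)$ with $S$ a nonempty set and $s:S\times S\to S\times S$ a map such that $s_{23}s_{13}s_{12}=s_{12}s_{23}$ on $S\times S\times S$, where $s_{12}=s\times\mathrm{id}$, $s_{23}=\mathrm{id}\times s$, $s_{13}=(\tau\times\mathrm{id})(\mathrm{id}\times s)(\tau\times\mathrm{id})$ and $\tau(x,y)=(y,x)$. It is bijective if $s$ is bijective. Writing $s(x,y)=(x\cdot y,\theta_x(y))$, $(S,\cdot)$ is a semigroup, and $E(S,\cdot)$ denotes its set of idempotents. A matched pair of groups $(G,A,\sigma,\delta)$ consists of groups $A$ and $G$, a left action $\sigma:A\to\mathrm{Sym}(G)$ (so $\sigma_{ab}=\sigma_a\sigma_b$) and a right action $\delta:G\to\mathrm{Sym}(A)$ (so $\delta_{xy}=\delta_y\delta_x$), such that for all $a,b\in A$, $x,y\in G$: $\sigma_a(xy)=\sigma_a(x)\,\sigma_{\delta_x(a)}(y)$ and $\delta_x(ab)=\delta_{\sigma_b(x)}(a)\,\delta_x(b)$. Irretractability: let $(S,s)$ be a bijective solution for which $(S,\cdot)$ is a left group (isomorphic to $E\times H$ with $E$ a nonempty set, $H$ a group,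 and $(e,g)(f,h)=(e,gh)$). Fix $e_0\in E(S,\cdot)$, put $1=\theta_{e_0}(e_0)$, which is an idempotent, and $G_1=1\cdot S$, a group. Every element of $S$ is uniquely $e\cdot g$ with $e\in E(S,\cdot)$, $g\in G_1$. Define $e\cdot g\approx f\cdot h$ (for $e,f\in E(S,\cdot)$, $g,h\in G_1$) iff $\theta_e=\theta_f$ and $g=h$. The solution is irretractable if $\approx$ is the equality relation. (This relation does not depend on the choice of $e_0$.) *)

theory Defs
  imports "HOL-Algebra.Group_Action"
begin

section \<open>Set-theoretic solutions to the Pentagon Equation\<close>

text \<open>Solutions live on a carrier set \<open>S\<close>; the values of \<open>s\<close> outside \<open>S \<times> S\<close> are irrelevant.\<close>

definition leg12 :: "('s \<times> 's \<Rightarrow> 's \<times> 's) \<Rightarrow> 's \<times> 's \<times> 's \<Rightarrow> 's \<times> 's \<times> 's" where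
  "leg12 s = (\<lambda>(x, y, z). case s (x, y) of (u, v) \<Rightarrow> (u, v, z))"

definition leg23 :: "('s \<times> 's \<Rightarrow> 's \<times> 's) \<Rightarrow> 's \<times> 's \<times> 's \<Rightarrow> 's \<times> 's \<times> 's" where
  "leg23 s = map_prod id s"

text \<open>Here \<open>leg12 prod.swap\<close> is \<open>\<tau> \<times> id\<close>.\<close>

definition leg13 :: "('s \<times> 's \<Rightarrow> 's \<times> 's) \<Rightarrow> 's \<times> 's \<times> 's \<Rightarrow> 's \<times> 's \<times> 's" where
  "leg13 s = leg12 prod.swap \<circ> leg23 s \<circ> leg12 prod.swap"

definition pentagon_solution :: "'s set \<Rightarrow> ('s \<times> 's \<Rightarrow> 's \<times> 's) \<Rightarrow> bool" where
  "pentagon_solution S s \<longleftrightarrow>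
     S \<noteq> {} \<and> s \<in> S \<times> S \<rightarrow> S \<times> S \<and>
     (\<forall>t \<in> S \<times> S \<times> S. (leg23 s \<circ> leg13 s \<circ> leg12 s) t = (leg12 s \<circ> leg23 s) t)"

definition bijective_pentagon_solution :: "'s set \<Rightarrow> ('s \<times> 's \<Rightarrow> 's \<times> 's) \<Rightarrow> bool" where
  "bijective_pentagon_solution S s \<longleftrightarrow>
     pentagon_solution S s \<and> bij_betw s (S \<times> S) (S \<times> S)"

text \<open>The two components of \<open>s(x, y) = (x \<cdot> y, \<theta>\<^sub>x(y))\<close>.\<close>

definition sol_mult :: "('s \<times> 's \<Rightarrow> 's \<times> 's) \<Rightarrow> 's \<Rightarrow> 's \<Rightarrow> 's" where
  "sol_mult s x y = fst (s (x, y))"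

definition sol_theta :: "('s \<times> 's \<Rightarrow> 's \<times> 's) \<Rightarrow> 's \<Rightarrow> 's \<Rightarrow> 's" where
  "sol_theta s x y = snd (s (x, y))"

definition idempotents :: "'s set \<Rightarrow> ('s \<Rightarrow> 's \<Rightarrow> 's) \<Rightarrow> 's set" where
  "idempotents S m = {e \<in> S. m e e = e}"

section \<open>Left groups and irretractability\<close>

text \<open>
  Taking \<open>E\<close> and \<open>H\<close> over the type of the elements of \<open>S\<close> loses no generality: if \<open>S\<close> is
  isomorphic to \<open>E \<times> H\<close>, then \<open>E\<close> is in bijection with the idempotents of \<open>S\<close>, and \<open>H\<close> is
  isomorphic to \<open>e \<cdot> S\<close> for any idempotent \<open>e\<close>.
\<close>

definition left_group :: "'s set \<Rightarrow> ('s \<Rightarrow> 's \<Rightarrow> 's) \<Rightarrow> bool" where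
  "left_group S m \<longleftrightarrow>
     (\<exists>(E :: 's set) (H :: 's monoid) \<phi>.
        E \<noteq> {} \<and> group H \<and> bij_betw \<phi> S (E \<times> carrier H) \<and>
        (\<forall>x\<in>S. \<forall>y\<in>S. m x y \<in> S \<and>
           \<phi> (m x y) = (fst (\<phi> x), snd (\<phi> x) \<otimes>\<^bsub>H\<^esub> snd (\<phi> y))))"

text \<open>The group \<open>G\<^sub>1 = 1 \<cdot> S\<close> with \<open>1 = \<theta>\<^sub>e\<^sub>0(e\<^sub>0)\<close>.\<close>

definition unit_part :: "'s set \<Rightarrow> ('s \<times> 's \<Rightarrow> 's \<times> 's) \<Rightarrow> 's \<Rightarrow> 's set" where
  "unit_part S s e0 = sol_mult s (sol_theta s e0 e0) ` S"

text \<open>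
  The relation \<open>\<approx>\<close> formed with a chosen idempotent \<open>e0\<close>. The maps \<open>\<theta>\<^sub>e\<close> and \<open>\<theta>\<^sub>f\<close> are maps
  on \<open>S\<close>, hence compared on \<open>S\<close>.
\<close>

definition retract_rel :: "'s set \<Rightarrow> ('s \<times> 's \<Rightarrow> 's \<times> 's) \<Rightarrow> 's \<Rightarrow> 's rel" where
  "retract_rel S s e0 =
     {(sol_mult s e g, sol_mult s f h) | e f g h.
        e \<in> idempotents S (sol_mult s) \<and> f \<in> idempotents S (sol_mult s) \<and>
        g \<in> unit_part S s e0 \<and> h \<in> unit_part S s e0 \<and>
        (\<forall>z\<in>S. sol_theta s e z = sol_theta s f z) \<and> g = h}"

text \<open>
  The relation does not depend on \<open>e0\<close>, so quantifying over all \<open>e0\<close> agrees with fixing one;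
  the quantification is never vacuous, as a left group has idempotents.
\<close>

definition irretractable :: "'s set \<Rightarrow> ('s \<times> 's \<Rightarrow> 's \<times> 's) \<Rightarrow> bool" where
  "irretractable S s \<longleftrightarrow>
     bijective_pentagon_solution S s \<and> left_group S (sol_mult s) \<and>
     (\<forall>e0 \<in> idempotents S (sol_mult s). retract_rel S s e0 = Id_on S)"

section \<open>Matched pairs of groups\<close>

text \<open>
  The group \<open>BijGroup X\<close> is \<open>Sym(X)\<close>, its elements being represented by functions that are
  \<open>undefined\<close> outside \<open>X\<close>, and its product is \<open>f \<otimes> g = f \<circ> g\<close> on \<open>X\<close>.
\<close>

locale matched_pair =
  G: group G + A: group A + left: group_action A "carrier G" \<sigma>
  for G :: "('g, 'm) monoid_scheme"
    and A :: "('a, 'n) monoid_scheme"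
    and \<sigma> :: "'a \<Rightarrow> 'g \<Rightarrow> 'g"
    and \<delta> :: "'g \<Rightarrow> 'a \<Rightarrow> 'a" +
  assumes right_sym: "x \<in> carrier G \<Longrightarrow> \<delta> x \<in> carrier (BijGroup (carrier A))"
    and right_mult: "\<lbrakk>x \<in> carrier G; y \<in> carrier G\<rbrakk> \<Longrightarrow>
      \<delta> (x \<otimes>\<^bsub>G\<^esub> y) = \<delta> y \<otimes>\<^bsub>BijGroup (carrier A)\<^esub> \<delta> x"
    and sigma_mult: "\<lbrakk>a \<in> carrier A; x \<in> carrier G; y \<in> carrier G\<rbrakk> \<Longrightarrow>
      \<sigma> a (x \<otimes>\<^bsub>G\<^esub> y) = \<sigma> a x \<otimes>\<^bsub>G\<^esub> \<sigma> (\<delta> x a) y"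
    and delta_mult: "\<lbrakk>a \<in> carrier A; b \<in> carrier A; x \<in> carrier G\<rbrakk> \<Longrightarrow>
      \<delta> x (a \<otimes>\<^bsub>A\<^esub> b) = \<delta> (\<sigma> b x) a \<otimes>\<^bsub>A\<^esub> \<delta> x b"

definition matched_pair_map ::
  "('g, 'm) monoid_scheme \<Rightarrow> ('a, 'n) monoid_scheme \<Rightarrow> ('a \<Rightarrow> 'g \<Rightarrow> 'g) \<Rightarrow> ('g \<Rightarrow> 'a \<Rightarrow> 'a) \<Rightarrow>
   ('a \<times> 'g) \<times> ('a \<times> 'g) \<Rightarrow> ('a \<times> 'g) \<times> ('a \<times> 'g)" where
  "matched_pair_map G A \<sigma> \<delta> =
     (\<lambda>((a, x), (b, y)).
        ((a, x \<otimes>\<^bsub>G\<^esub> y), (b \<otimes>\<^bsub>A\<^esub> inv\<^bsub>A\<^esub> (\<delta> x a), \<sigma> (\<delta> x a) y)))"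

end

theory Submission
  imports Defs "HOL-Algebra.Elementary_Groups"
begin

text \<open>
  The identities \<open>\<sigma>\<^sub>c(yz) = \<sigma>\<^sub>c(y) \<sigma>\<^bsub>\<delta>\<^sub>y(c)\<^esub>(z)\<close> and
  \<open>\<delta>\<^bsub>\<sigma>\<^sub>c(y)\<^esub>(bc\<inverse>) \<delta>\<^sub>y(c) = \<delta>\<^sub>y(b)\<close>, taken at \<open>c = \<delta>\<^sub>x(a)\<close>, are exactly what the
  Pentagon Equation asks for. The equation \<open>s((a, x), (b, y)) = ((a, u), (d, v))\<close> forces
  \<open>\<sigma>\<^sub>a(u) = \<sigma>\<^sub>a(x) v\<close>, which determines \<open>x\<close>, hence \<open>y\<close> and \<open>b\<close>. The idempotents are the
  pairs \<open>(a, 1)\<close>, and \<open>\<theta>\<^bsub>(a, 1)\<^esub>(1, 1) = (a\<inverse>, 1)\<close> recovers \<open>a\<close>.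
\<close>

context matched_pair
begin

abbreviation "S \<equiv> carrier A \<times> carrier G"
abbreviation "s \<equiv> matched_pair_map G A \<sigma> \<delta>"

lemma s_apply [simp]:
  "s ((a, x), (b, y)) = ((a, x \<otimes>\<^bsub>G\<^esub> y), (b \<otimes>\<^bsub>A\<^esub> inv\<^bsub>A\<^esub> (\<delta> x a), \<sigma> (\<delta> x a) y))"
  by (simp add: matched_pair_map_def)

lemma sol_mult_apply [simp]: "sol_mult s (a, x) (b, y) = (a, x \<otimes>\<^bsub>G\<^esub> y)"
  by (simp add: sol_mult_def)

lemma sol_theta_apply [simp]:
  "sol_theta s (a, x) (b, y) = (b \<otimes>\<^bsub>A\<^esub> inv\<^bsub>A\<^esub> (\<delta> x a), \<sigma> (\<delta> x a) y)"
  by (simp add: sol_theta_def)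

lemma sigma_closed [simp]: "\<lbrakk>a \<in> carrier A; x \<in> carrier G\<rbrakk> \<Longrightarrow> \<sigma> a x \<in> carrier G"
  by (rule left.element_image) auto

lemma delta_bij: "x \<in> carrier G \<Longrightarrow> bij_betw (\<delta> x) (carrier A) (carrier A)"
  using right_sym by (auto simp: BijGroup_def Bij_def)

lemma delta_closed [simp]: "\<lbrakk>a \<in> carrier A; x \<in> carrier G\<rbrakk> \<Longrightarrow> \<delta> x a \<in> carrier A"
  using delta_bij bij_betwE by blast

lemma sigma_bij: "a \<in> carrier A \<Longrightarrow> bij_betw (\<sigma> a) (carrier G) (carrier G)"
  by (simp add: bij_betw_def left.inj_prop left.surj_prop)

lemma sigma_sigma:
  "\<lbrakk>a \<in> carrier A; b \<in> carrier A; x \<in> carrier G\<rbrakk> \<Longrightarrow> \<sigma> a (\<sigma> b x) = \<sigma> (a \<otimes>\<^bsub>A\<^esub> b) x"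
  by (simp add: left.composition_rule)

lemma delta_delta:
  assumes "x \<in> carrier G" "y \<in> carrier G" "a \<in> carrier A"
  shows "\<delta> y (\<delta> x a) = \<delta> (x \<otimes>\<^bsub>G\<^esub> y) a"
  using assms right_mult[OF assms(1,2)] right_sym
  by (simp add: BijGroup_def compose_def)

text \<open>Since \<open>\<one> \<otimes> \<one> = \<one>\<close> in \<open>G\<close>, the map
  \<open>\<delta> \<one>\<close> is idempotent, and an injective idempotent map is the
  identity.\<close>

lemma delta_one [simp]:
  assumes "a \<in> carrier A"
  shows "\<delta> \<one>\<^bsub>G\<^esub> a = a"
proof -
  have "\<delta> \<one>\<^bsub>G\<^esub> (\<delta> \<one>\<^bsub>G\<^esub> a) = \<delta> \<one>\<^bsub>G\<^esub> a"
    using assms by (simp add: delta_delta)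
  then show ?thesis
    using assms delta_bij[of "\<one>\<^bsub>G\<^esub>"] by (auto simp: bij_betw_def dest: inj_onD)
qed

text \<open>As \<open>\<delta> \<one>\<close> fixes \<open>a\<close>, the law
  \<open>sigma_mult\<close> at \<open>x = y = \<one>\<close> makes \<open>\<sigma> a \<one>\<close>
  an idempotent of the group \<open>G\<close>.\<close>

lemma sigma_one [simp]:
  assumes "a \<in> carrier A"
  shows "\<sigma> a \<one>\<^bsub>G\<^esub> = \<one>\<^bsub>G\<^esub>"
proof -
  have "\<sigma> a \<one>\<^bsub>G\<^esub> \<otimes>\<^bsub>G\<^esub> \<sigma> a \<one>\<^bsub>G\<^esub> = \<sigma> a \<one>\<^bsub>G\<^esub>"
    using sigma_mult[of a "\<one>\<^bsub>G\<^esub>" "\<one>\<^bsub>G\<^esub>", symmetric] assms by simp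
  then show ?thesis
    using assms by simp
qed

text \<open>This is \<open>delta_mult\<close> for the factorization of \<open>b\<close> as
  \<open>b\<close> times the inverse of \<open>c\<close>, times \<open>c\<close>; quotients of this
  shape are what \<open>s\<close> produces.\<close>

lemma delta_quotient:
  assumes "b \<in> carrier A" "c \<in> carrier A" "y \<in> carrier G"
  shows "\<delta> (\<sigma> c y) (b \<otimes>\<^bsub>A\<^esub> inv\<^bsub>A\<^esub> c) \<otimes>\<^bsub>A\<^esub> \<delta> y c = \<delta> y b"
  using delta_mult[of "b \<otimes>\<^bsub>A\<^esub> inv\<^bsub>A\<^esub> c" c y] assms by (simp add: A.m_assoc)

lemma s_closed: "s \<in> S \<times> S \<rightarrow> S \<times> S"
  by auto

lemma pentagon_equation:
  assumes "a \<in> carrier A" "b \<in> carrier A" "d \<in> carrier A"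
    and "x \<in> carrier G" "y \<in> carrier G" "z \<in> carrier G"
  shows "(leg23 s \<circ> leg13 s \<circ> leg12 s) ((a, x), (b, y), (d, z)) =
         (leg12 s \<circ> leg23 s) ((a, x), (b, y), (d, z))"
proof -
  \<comment> \<open>\<open>c\<close> is the element that acts when \<open>leg12 s\<close> is applied
    first; \<open>e\<close> is the one that acts in the final \<open>leg23 s\<close>, whose left
    argument is the second entry left by \<open>leg12 s\<close>.\<close>
  define c where "c = \<delta> x a"
  define e where "e = \<delta> (\<sigma> c y) (b \<otimes>\<^bsub>A\<^esub> inv\<^bsub>A\<^esub> c)"
  have closed: "c \<in> carrier A" "e \<in> carrier A"
    using assms by (simp_all add: c_def e_def)
  have xy: "\<delta> (x \<otimes>\<^bsub>G\<^esub> y) a = \<delta> y c"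
    using assms by (simp add: c_def delta_delta)
  have e: "e \<otimes>\<^bsub>A\<^esub> \<delta> y c = \<delta> y b"
    using assms closed by (simp add: e_def delta_quotient)
  \<comment> \<open>The two sides are compared by coordinates: first both coordinates of the third
    entry, then the \<open>G\<close>-coordinate of the second. The rest agrees by associativity in
    \<open>G\<close>.\<close>
  have "d \<otimes>\<^bsub>A\<^esub> inv\<^bsub>A\<^esub> (\<delta> y c) \<otimes>\<^bsub>A\<^esub> inv\<^bsub>A\<^esub> e = d \<otimes>\<^bsub>A\<^esub> inv\<^bsub>A\<^esub> (\<delta> y b)"
    using assms closed by (simp add: e[symmetric] A.inv_mult_group A.m_assoc)
  moreover have "\<sigma> e (\<sigma> (\<delta> y c) z) = \<sigma> (\<delta> y b) z"
    using assms closed by (simp add: sigma_sigma e)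
  moreover have "\<sigma> c (y \<otimes>\<^bsub>G\<^esub> z) = \<sigma> c y \<otimes>\<^bsub>G\<^esub> \<sigma> (\<delta> y c) z"
    using assms closed by (simp add: sigma_mult)
  ultimately show ?thesis
    using assms
    by (simp add: leg12_def leg13_def leg23_def xy G.m_assoc flip: c_def e_def)
qed

lemma s_inj: "inj_on s (S \<times> S)"
proof (rule inj_onI, clarsimp)
  fix a b b' x x' y y'
  assume carr: "a \<in> carrier A" "b \<in> carrier A" "b' \<in> carrier A"
    "x \<in> carrier G" "x' \<in> carrier G" "y \<in> carrier G" "y' \<in> carrier G"
  assume u: "x \<otimes>\<^bsub>G\<^esub> y = x' \<otimes>\<^bsub>G\<^esub> y'"
    and d: "b \<otimes>\<^bsub>A\<^esub> inv\<^bsub>A\<^esub> (\<delta> x a) = b' \<otimes>\<^bsub>A\<^esub> inv\<^bsub>A\<^esub> (\<delta> x' a)"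
    and v: "\<sigma> (\<delta> x a) y = \<sigma> (\<delta> x' a) y'"
  \<comment> \<open>By \<open>u\<close>, applying \<open>\<sigma> a\<close> to both products gives
    equal results; \<open>v\<close> identifies their right factors, which then cancel.\<close>
  have "\<sigma> a x \<otimes>\<^bsub>G\<^esub> \<sigma> (\<delta> x a) y = \<sigma> a x' \<otimes>\<^bsub>G\<^esub> \<sigma> (\<delta> x a) y"
    using carr u v sigma_mult[of a x y] sigma_mult[of a x' y'] by simp
  then have "\<sigma> a x = \<sigma> a x'"
    using carr by simp
  then have "x = x'"
    using carr sigma_bij[of a] by (auto simp: bij_betw_def dest: inj_onD)
  then show "x = x' \<and> b = b' \<and> y = y'"
    using carr u d by simp
qed

lemma s_surj: "S \<times> S \<subseteq> s ` (S \<times> S)"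
proof clarify
  fix a u d v
  assume carr: "a \<in> carrier A" "d \<in> carrier A" "u \<in> carrier G" "v \<in> carrier G"
  have "\<sigma> a u \<otimes>\<^bsub>G\<^esub> inv\<^bsub>G\<^esub> v \<in> \<sigma> a ` carrier G"
    using carr sigma_bij[of a] by (simp add: bij_betw_def)
  then obtain x where x: "x \<in> carrier G" "\<sigma> a x = \<sigma> a u \<otimes>\<^bsub>G\<^esub> inv\<^bsub>G\<^esub> v"
    by auto
  \<comment> \<open>With \<open>x\<close> solving
    \<open>\<sigma> a u = \<sigma> a x \<otimes> v\<close>, the coordinates \<open>u\<close> and
    \<open>d\<close> of the target force \<open>y\<close> and \<open>b\<close>; only the coordinate
    \<open>v\<close> remains to be checked.\<close>
  define y where "y = inv\<^bsub>G\<^esub> x \<otimes>\<^bsub>G\<^esub> u"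
  define b where "b = d \<otimes>\<^bsub>A\<^esub> \<delta> x a"
  have y: "y \<in> carrier G" "x \<otimes>\<^bsub>G\<^esub> y = u"
    using carr x by (simp_all add: y_def flip: G.m_assoc)
  have b: "b \<in> carrier A" "b \<otimes>\<^bsub>A\<^esub> inv\<^bsub>A\<^esub> (\<delta> x a) = d"
    using carr x by (simp_all add: b_def A.m_assoc)
  have "\<sigma> a x \<otimes>\<^bsub>G\<^esub> \<sigma> (\<delta> x a) y = \<sigma> a x \<otimes>\<^bsub>G\<^esub> v"
    using carr x y sigma_mult[of a x y] by (simp add: G.m_assoc)
  then have "\<sigma> (\<delta> x a) y = v"
    using carr x(1) y by simp
  then have "((a, u), (d, v)) = s ((a, x), (b, y))"
    using y b by simp
  then show "((a, u), (d, v)) \<in> s ` (S \<times> S)"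
    using carr x(1) y(1) b(1) by blast
qed

lemma bijective_solution: "bijective_pentagon_solution S s"
proof -
  have "S \<noteq> {}"
    using A.one_closed G.one_closed by blast
  moreover have "s ` (S \<times> S) = S \<times> S"
    using s_closed s_surj by blast
  ultimately show ?thesis
    unfolding bijective_pentagon_solution_def pentagon_solution_def bij_betw_def
    \<comment> \<open>The compositions must stay folded to match
      \<open>pentagon_equation\<close>.\<close>
    using s_closed s_inj pentagon_equation by (auto simp del: comp_apply)
qed

lemma left_group: "left_group S (sol_mult s)"
proof -
  \<comment> \<open>\<open>left_group\<close> wants both factors over the type of pairs, so
    \<open>A\<close> and \<open>G\<close> are each padded with a trivial coordinate.\<close>
  let ?E = "carrier A \<times> {\<one>\<^bsub>G\<^esub>}"
  let ?H = "singleton_group \<one>\<^bsub>A\<^esub> \<times>\<times> G"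
  let ?\<phi> = "\<lambda>(a, x). ((a, \<one>\<^bsub>G\<^esub>), (\<one>\<^bsub>A\<^esub>, x))"
  have "group ?H"
    by (intro DirProd_group singleton_group G.group_axioms)
  moreover have "bij_betw ?\<phi> S (?E \<times> carrier ?H)"
    by (auto simp: bij_betw_def inj_on_def image_iff)
  moreover have "\<forall>p\<in>S. \<forall>q\<in>S. sol_mult s p q \<in> S \<and>
      ?\<phi> (sol_mult s p q) = (fst (?\<phi> p), snd (?\<phi> p) \<otimes>\<^bsub>?H\<^esub> snd (?\<phi> q))"
    by (auto simp: singleton_group_def)
  moreover have "?E \<noteq> {}"
    by auto
  ultimately show ?thesis
    unfolding left_group_def
    by (intro exI[of _ ?E] exI[of _ ?H] exI[of _ ?\<phi>] conjI)
qed

lemma idempotents_eq: "idempotents S (sol_mult s) = carrier A \<times> {\<one>\<^bsub>G\<^esub>}"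
  by (auto simp: idempotents_def)

text \<open>Whichever idempotent \<open>e0\<close> is chosen, \<open>\<theta>\<close> of
  \<open>e0\<close> at \<open>e0\<close> is the pair of units, because the first coordinate becomes
  \<open>a\<close> times its own inverse.\<close>

lemma unit_part_eq:
  assumes "e0 \<in> idempotents S (sol_mult s)"
  shows "unit_part S s e0 = {\<one>\<^bsub>A\<^esub>} \<times> carrier G"
proof -
  obtain a where a: "e0 = (a, \<one>\<^bsub>G\<^esub>)" "a \<in> carrier A"
    using assms by (auto simp: idempotents_eq)
  then have "sol_theta s e0 e0 = (\<one>\<^bsub>A\<^esub>, \<one>\<^bsub>G\<^esub>)"
    by simp
  then have "unit_part S s e0 = (\<lambda>p. (\<one>\<^bsub>A\<^esub>, snd p)) ` S"
    unfolding unit_part_def by (intro image_cong) auto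
  also have "\<dots> = {\<one>\<^bsub>A\<^esub>} \<times> carrier G"
    using a(2) by force
  finally show ?thesis .
qed

lemma sol_theta_inj:
  assumes "a \<in> carrier A" "b \<in> carrier A"
    and "\<forall>z\<in>S. sol_theta s (a, \<one>\<^bsub>G\<^esub>) z = sol_theta s (b, \<one>\<^bsub>G\<^esub>) z"
  shows "a = b"
proof -
  have "sol_theta s (a, \<one>\<^bsub>G\<^esub>) (\<one>\<^bsub>A\<^esub>, \<one>\<^bsub>G\<^esub>) = sol_theta s (b, \<one>\<^bsub>G\<^esub>) (\<one>\<^bsub>A\<^esub>, \<one>\<^bsub>G\<^esub>)"
    using assms(3) by blast
  then have "inv\<^bsub>A\<^esub> a = inv\<^bsub>A\<^esub> b"
    using assms by simp
  then show ?thesis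
    using assms by (metis A.inv_inv)
qed

lemma retract_rel_eq:
  assumes "e0 \<in> idempotents S (sol_mult s)"
  shows "retract_rel S s e0 = Id_on S"
proof (intro equalityI subsetI)
  fix p assume "p \<in> retract_rel S s e0"
  then obtain a b x where p: "p = ((a, x), (b, x))"
    and carr: "a \<in> carrier A" "b \<in> carrier A" "x \<in> carrier G"
    and "\<forall>z\<in>S. sol_theta s (a, \<one>\<^bsub>G\<^esub>) z = sol_theta s (b, \<one>\<^bsub>G\<^esub>) z"
    unfolding retract_rel_def idempotents_eq unit_part_eq[OF assms] by clarsimp
  then show "p \<in> Id_on S"
    using sol_theta_inj[of a b] p carr by (simp add: Id_on_iff)
next
  fix p assume "p \<in> Id_on S"
  then obtain a x where p: "p = ((a, x), (a, x))" "a \<in> carrier A" "x \<in> carrier G"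
    by auto
  then show "p \<in> retract_rel S s e0"
    unfolding retract_rel_def idempotents_eq unit_part_eq[OF assms] mem_Collect_eq
    \<comment> \<open>The factorization of \<open>(a, x)\<close> into the idempotent
      \<open>(a, \<one>)\<close> and the group element \<open>(\<one>, x)\<close> serves for both
      entries of the pair \<open>p\<close>.\<close>
    by (intro exI[of _ "(a, \<one>\<^bsub>G\<^esub>)"] exI[of _ "(\<one>\<^bsub>A\<^esub>, x)"]) simp
qed

end

theorem theorem4p1:
  fixes G :: "('g, 'm) monoid_scheme"
    and A :: "('a, 'n) monoid_scheme"
    and \<sigma> :: "'a \<Rightarrow> 'g \<Rightarrow> 'g"
    and \<delta> :: "'g \<Rightarrow> 'a \<Rightarrow> 'a"
  assumes "matched_pair G A \<sigma> \<delta>"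
  shows "bijective_pentagon_solution (carrier A \<times> carrier G) (matched_pair_map G A \<sigma> \<delta>) \<and>
         irretractable (carrier A \<times> carrier G) (matched_pair_map G A \<sigma> \<delta>)"
proof -
  interpret matched_pair G A \<sigma> \<delta>
    by (rule assms)
  show ?thesis
    unfolding irretractable_def
    using bijective_solution left_group retract_rel_eq by blast
qed

end
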